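(* Let $a\in L^1(I)$ and $\lambda\in\mathbb{R}$. If the operator $L[\lambda]$ is nonresonant both in $X_D$ and in $X_P$, then for all $(t,s)\in I\times I$ $$G_D[\lambda](t,s)=G_P[\lambda](t,s)+r_4[\lambda](t)\Big(\frac{\partial}{\partial t}G_D[\lambda](0,s)-\frac{\partial}{\partial t}G_D[\lambda](1,s)\Big)$$ $$=G_P[\lambda](t,s)+G_P[\lambda](t,0)\Big(\frac{\partial}{\partial t}G_D[\lambda](0,s)-\frac{\partial}{\partial t}G_D[\lambda](1,s)\Big).$$
   Context: $I=[0,1]$, $a\in L^1(I)$ is real-valued, $\lambda\in\mathbb{R}$, and $L[\lambda]u(t)=u''(t)+(a(t)+\lambda)u(t)$. $W^{2,1}(I)=\{u\in C(I):u'\in AC(I)\}$, where $AC(I)$ is the set of absolutely continuous functions on $I$. $X_D=\{u\in W^{2,1}(I):u(0)=u(1)=0\}$ (Dirichlet) and $X_P=\{u\in W^{2,1}(I):u(0)=u(1),\,u'(0)=u'(1)\}$ (periodic). $L[\lambda]$ is nonresonant in $X$ if $u=0$ is the only $u\in X$ with $L[\lambda]u=0$ a.e. on $I$. In that case, for every $\sigma\in L^1(I)$ the problem $L[\lambda]u=\sigma$ a.e. on $I$, $u\in X$, has a unique solution, given by $u(t)=\int_0^1G(t,s)\sigma(s)\,ds$, where the continuous function $G:I\times I\to\mathbb{R}$ is the Green's function; it is denoted $G_D[\lambda]$ for $X=X_D$ and $G_P[\lambda]$ for $X=X_P$. $r_4[\lambda]$ is the unique solution of $L[\lambda]u=0$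 a.e. on $I$, $u(0)-u(1)=0$, $u'(0)-u'(1)=1$. Convention: $\frac{\partial}{\partial t}G(0,s)$ and $\frac{\partial}{\partial t}G(1,s)$ (derivative with respect to the first variable, at $t=0$, $t=1$) are one-sided derivatives for $s\in(0,1)$, extended by continuity to $s\in\{0,1\}$. *)

theory Defs
  imports "HOL-Analysis.Analysis"
begin

text \<open>Functions on the unit interval are total functions of which only the values on
  \<open>{0..1}\<close> matter: derivatives are taken within \<open>{0..1}\<close>, hence are one-sided at the end points,
  and equality of functions is equality on \<open>{0..1}\<close>. \<open>L\<^sup>1\<close> is
  \<open>absolutely_integrable_on {0..1}\<close>.\<close>

text \<open>The usual epsilon-delta definition. The finite families of non-overlapping closed
  subintervals are the \<open>division_of\<close> some subset of \<open>{a..b}\<close>;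
  \<open>Inf k\<close> and \<open>Sup k\<close> are the end points of the interval \<open>k\<close>.\<close>

definition abs_continuous_on :: "real \<Rightarrow> real \<Rightarrow> (real \<Rightarrow> real) \<Rightarrow> bool" where
  "abs_continuous_on a b f \<longleftrightarrow>
     (\<forall>\<epsilon>>0. \<exists>\<delta>>0. \<forall>\<D> S. \<D> division_of S \<and> S \<subseteq> {a..b} \<and> (\<Sum>k\<in>\<D>. Sup k - Inf k) < \<delta> \<longrightarrow>
        (\<Sum>k\<in>\<D>. \<bar>f (Sup k) - f (Inf k)\<bar>) < \<epsilon>)"

definition D :: "(real \<Rightarrow> real) \<Rightarrow> real \<Rightarrow> real" where
  "D u t = vector_derivative u (at t within {0..1})"

definition W21 :: "(real \<Rightarrow> real) set" where
  "W21 = {u. (\<forall>t\<in>{0..1}. u differentiable (at t within {0..1})) \<and> abs_continuous_on 0 1 (D u)}"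

definition X_Dirichlet :: "(real \<Rightarrow> real) set" where
  "X_Dirichlet = {u \<in> W21. u 0 = 0 \<and> u 1 = 0}"

definition X_periodic :: "(real \<Rightarrow> real) set" where
  "X_periodic = {u \<in> W21. u 0 = u 1 \<and> D u 0 = D u 1}"

definition L :: "(real \<Rightarrow> real) \<Rightarrow> real \<Rightarrow> (real \<Rightarrow> real) \<Rightarrow> real \<Rightarrow> real" where
  "L a lam u t = D (D u) t + (a t + lam) * u t"

text \<open>\<open>L[lam]u = \<sigma>\<close> almost everywhere. As \<open>D\<close> is a total function, the existence of \<open>u''\<close> at almost
  every point is spelt out.\<close>

definition solves :: "(real \<Rightarrow> real) \<Rightarrow> real \<Rightarrow> (real \<Rightarrow> real) \<Rightarrow> (real \<Rightarrow> real) \<Rightarrow> bool" where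
  "solves a lam \<sigma> u \<longleftrightarrow>
     (AE t\<in>{0..1} in lborel. D u differentiable (at t within {0..1}) \<and> L a lam u t = \<sigma> t)"

definition nonresonant :: "(real \<Rightarrow> real) \<Rightarrow> real \<Rightarrow> (real \<Rightarrow> real) set \<Rightarrow> bool" where
  "nonresonant a lam X \<longleftrightarrow> (\<forall>u\<in>X. solves a lam (\<lambda>_. 0) u \<longrightarrow> (\<forall>t\<in>{0..1}. u t = 0))"

text \<open>For nonresonant \<open>L[lam]\<close> the solution in \<open>X\<close> is unique, so that the integral below is the
  solution; this determines the continuous kernel \<open>G\<close> on the unit square.\<close>

definition is_greens_function ::
    "(real \<Rightarrow> real) \<Rightarrow> real \<Rightarrow> (real \<Rightarrow> real) set \<Rightarrow> (real \<Rightarrow> real \<Rightarrow> real) \<Rightarrow> bool" where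
  "is_greens_function a lam X G \<longleftrightarrow>
     continuous_on ({0..1} \<times> {0..1}) (\<lambda>(t, s). G t s) \<and>
     (\<forall>\<sigma>. \<sigma> absolutely_integrable_on {0..1} \<longrightarrow>
        (\<lambda>t. LINT s:{0..1}|lebesgue. G t s * \<sigma> s) \<in> X \<and>
        solves a lam \<sigma> (\<lambda>t. LINT s:{0..1}|lebesgue. G t s * \<sigma> s))"

definition is_r4 :: "(real \<Rightarrow> real) \<Rightarrow> real \<Rightarrow> (real \<Rightarrow> real) \<Rightarrow> bool" where
  "is_r4 a lam r \<longleftrightarrow>
     r \<in> W21 \<and> solves a lam (\<lambda>_. 0) r \<and> r 0 - r 1 = 0 \<and> D r 0 - D r 1 = 1"

text \<open>The partial derivative of \<open>G\<close> in its first variable at the end point \<open>t\<close> (0 or 1), for fixed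
  \<open>s\<close> in the open interval, extended by continuity to \<open>s = 0\<close> and \<open>s = 1\<close>. The extension differs from
  the plain one-sided derivative at the corners of the square.\<close>

definition dt :: "(real \<Rightarrow> real \<Rightarrow> real) \<Rightarrow> real \<Rightarrow> real \<Rightarrow> real" where
  "dt G t s =
     (if s \<in> {0<..<1} then D (\<lambda>\<tau>. G \<tau> s) t
      else Lim (at s within {0<..<1}) (\<lambda>x. D (\<lambda>\<tau>. G \<tau> x) t))"

end

theory Submission
  imports Defs
begin

text \<open>Let \<open>v0\<close> and \<open>v1\<close> be the solutions of \<open>L[lam]v = 0\<close> with boundary values \<open>(1, 0)\<close> and
  \<open>(0, 1)\<close>. They exist because the Dirichlet problem is solvable for every right-hand side: the
  Green's function supplies the correction that turns an affine function with the desired boundary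
  values into a solution (\<open>homogeneous_solution_boundary_values\<close>).

  For homogeneous \<open>v\<close> and \<open>L[lam]u = \<sigma>\<close>, Green's identity \<open>(v u' - v' u)' = v \<sigma>\<close>
  (\<open>greens_identity\<close>) has two consequences.

  \<^item> Applied to a Dirichlet solution \<open>u\<close> on \<open>{0..t}\<close> with \<open>v1\<close> and on \<open>{t..1}\<close> with \<open>v0\<close>, it
    gives the classical formula \<open>G_D t s = - v1 (min s t) * v0 (max s t) / v1' 0\<close>
    (\<open>dirichlet_greens_function\<close>), from which the derivatives of \<open>G_D\<close> at \<open>t = 0\<close> and \<open>t = 1\<close>
    are read off as \<open>- v0 s\<close> and \<open>v1 s\<close> (\<open>dirichlet_greens_function_dt\<close>).

  \<^item> Applied on the whole interval, it gives \<open>u' 0 = - \<integral> v0 \<sigma>\<close> and \<open>u' 1 = \<integral> v1 \<sigma>\<close>.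

  If \<open>u\<close> and \<open>p\<close> are the Dirichlet and the periodic solution for the same \<open>\<sigma>\<close>, then
  \<open>u - p - (u' 0 - u' 1) r4\<close> is homogeneous and periodic, hence zero. Writing all terms as integrals
  against the arbitrary function \<open>\<sigma>\<close> and comparing the continuous kernels gives
  \<open>G_D t s = G_P t s - r4 t * (v0 s + v1 s)\<close> (\<open>dirichlet_periodic_kernel\<close>), which is the first
  equation. At \<open>s = 0\<close> the left-hand side vanishes and \<open>v0 0 + v1 0 = 1\<close>, so \<open>r4 t = G_P t 0\<close>,
  which is the second.

  Two analytic facts support this: the fundamental theorem of calculus for absolutely continuous
  functions (\<open>fundamental_theorem_of_calculus_abs_continuous\<close>), without which Green's identity could
  not be integrated, and uniqueness for the initial value problem (\<open>solution_zero_initial_data\<close>),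
  which shows that the denominator \<open>v1' 0\<close> is nonzero.\<close>

section \<open>Absolutely continuous functions\<close>

lemma division_of_real_element:
  fixes S :: "real set"
  assumes "\<D> division_of S" "k \<in> \<D>"
  obtains u v where "k = {u..v}" "u \<le> v" "k \<subseteq> S"
proof -
  obtain u v where "k = cbox u v" using division_ofD(4)[OF assms] by blast
  moreover have "k \<noteq> {}" "k \<subseteq> S" using division_ofD(2,3)[OF assms] by auto
  ultimately show ?thesis by (intro that[of u v]) auto
qed

lemma abs_continuous_onD:
  assumes "abs_continuous_on a b f" "\<epsilon> > 0"
  shows "\<exists>\<delta>>0. \<forall>\<D> S. \<D> division_of S \<longrightarrow> S \<subseteq> {a..b} \<longrightarrow> (\<Sum>k\<in>\<D>. Sup k - Inf k) < \<delta> \<longrightarrow>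
      (\<Sum>k\<in>\<D>. \<bar>f (Sup k) - f (Inf k)\<bar>) < \<epsilon>"
proof -
  obtain \<delta> where "\<delta> > 0" and "\<forall>\<D> S. \<D> division_of S \<and> S \<subseteq> {a..b} \<and> (\<Sum>k\<in>\<D>. Sup k - Inf k) < \<delta> \<longrightarrow>
      (\<Sum>k\<in>\<D>. \<bar>f (Sup k) - f (Inf k)\<bar>) < \<epsilon>"
    using assms unfolding abs_continuous_on_def by blast
  then show ?thesis by (intro exI[of _ \<delta>]) blast
qed

text \<open>One estimate yields the closure properties: linear combinations, products and Lipschitz functions
  are all dominated in this way by functions already known to be absolutely continuous.\<close>

lemma abs_continuous_on_dominated2:
  assumes f: "abs_continuous_on a b f" and g: "abs_continuous_on a b g"
    and h: "\<And>x y. x \<in> {a..b} \<Longrightarrow> y \<in> {a..b} \<Longrightarrow>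
              \<bar>h y - h x\<bar> \<le> A * \<bar>f y - f x\<bar> + B * \<bar>g y - g x\<bar>"
  shows "abs_continuous_on a b h"
  unfolding abs_continuous_on_def
proof (intro allI impI)
  fix e :: real assume "e > 0"
  define C where "C = \<bar>A\<bar> + \<bar>B\<bar> + 1"
  have C: "C > 0" "\<bar>A\<bar> + \<bar>B\<bar> \<le> C" by (auto simp: C_def)
  have "e / C > 0" using \<open>e > 0\<close> C by simp
  obtain d1 where d1: "d1 > 0"
    "\<forall>\<D> S. \<D> division_of S \<longrightarrow> S \<subseteq> {a..b} \<longrightarrow> (\<Sum>k\<in>\<D>. Sup k - Inf k) < d1 \<longrightarrow>
        (\<Sum>k\<in>\<D>. \<bar>f (Sup k) - f (Inf k)\<bar>) < e / C"
    using abs_continuous_onD[OF f \<open>e / C > 0\<close>] by blast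
  obtain d2 where d2: "d2 > 0"
    "\<forall>\<D> S. \<D> division_of S \<longrightarrow> S \<subseteq> {a..b} \<longrightarrow> (\<Sum>k\<in>\<D>. Sup k - Inf k) < d2 \<longrightarrow>
        (\<Sum>k\<in>\<D>. \<bar>g (Sup k) - g (Inf k)\<bar>) < e / C"
    using abs_continuous_onD[OF g \<open>e / C > 0\<close>] by blast
  show "\<exists>\<delta>>0. \<forall>\<D> S. \<D> division_of S \<and> S \<subseteq> {a..b} \<and> (\<Sum>k\<in>\<D>. Sup k - Inf k) < \<delta> \<longrightarrow>
        (\<Sum>k\<in>\<D>. \<bar>h (Sup k) - h (Inf k)\<bar>) < e"
  proof (intro exI[of _ "min d1 d2"] conjI allI impI; (elim conjE)?)
    show "min d1 d2 > 0" using d1(1) d2(1) by simp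
  next
    fix \<D> S assume *: "\<D> division_of S" "S \<subseteq> {a..b}" "(\<Sum>k\<in>\<D>. Sup k - Inf k) < min d1 d2"
    define F where "F = (\<Sum>k\<in>\<D>. \<bar>f (Sup k) - f (Inf k)\<bar>)"
    define G where "G = (\<Sum>k\<in>\<D>. \<bar>g (Sup k) - g (Inf k)\<bar>)"
    have FG: "F < e / C" "G < e / C" "F \<ge> 0" "G \<ge> 0"
      unfolding F_def G_def using d1(2)[rule_format, OF *(1,2)] d2(2)[rule_format, OF *(1,2)] *(3) by (auto intro: sum_nonneg)
    have "(\<Sum>k\<in>\<D>. \<bar>h (Sup k) - h (Inf k)\<bar>)
          \<le> (\<Sum>k\<in>\<D>. A * \<bar>f (Sup k) - f (Inf k)\<bar> + B * \<bar>g (Sup k) - g (Inf k)\<bar>)"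
    proof (rule sum_mono, rule h)
      fix k assume "k \<in> \<D>"
      with *(1) obtain u v where "k = {u..v}" "u \<le> v" "k \<subseteq> S"
        by (rule division_of_real_element)
      moreover from this have "u \<in> {a..b}" "v \<in> {a..b}"
        using subset_trans[OF _ *(2), of "{u..v}"] by auto
      ultimately show "Sup k \<in> {a..b}" "Inf k \<in> {a..b}" by auto
    qed
    also have "\<dots> = A * F + B * G"
      by (simp add: F_def G_def sum.distrib sum_distrib_left)
    also have "\<dots> \<le> \<bar>A\<bar> * max F G + \<bar>B\<bar> * max F G"
      using FG by (intro add_mono mult_mono) auto
    also have "\<dots> = (\<bar>A\<bar> + \<bar>B\<bar>) * max F G" by (simp add: algebra_simps)
    also have "\<dots> \<le> C * max F G" using FG C by (intro mult_right_mono) auto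
    also have "\<dots> < C * (e / C)" using FG C by (intro mult_strict_left_mono) auto
    finally show "(\<Sum>k\<in>\<D>. \<bar>h (Sup k) - h (Inf k)\<bar>) < e" using C by simp
  qed
qed

lemma abs_continuous_on_lipschitz:
  assumes h: "\<And>x y. x \<in> {a..b} \<Longrightarrow> y \<in> {a..b} \<Longrightarrow> \<bar>h y - h x\<bar> \<le> A * \<bar>y - x\<bar>"
  shows "abs_continuous_on a b h"
proof -
  have id: "abs_continuous_on a b (\<lambda>x. x)"
    unfolding abs_continuous_on_def
  proof (intro allI impI)
    fix e :: real assume e: "e > 0"
    have eq: "(\<Sum>k\<in>\<D>. \<bar>Sup k - Inf k\<bar>) = (\<Sum>k\<in>\<D>. Sup k - Inf k)"
      if div: "\<D> division_of S" for \<D> and S :: "real set"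
    proof (rule sum.cong[OF refl])
      fix k assume "k \<in> \<D>"
      from div this obtain u v where k: "k = {u..v}" "u \<le> v" by (rule division_of_real_element)
      then show "\<bar>Sup k - Inf k\<bar> = Sup k - Inf k" by auto
    qed
    show "\<exists>\<delta>>0. \<forall>\<D> S. \<D> division_of S \<and> S \<subseteq> {a..b} \<and> (\<Sum>k\<in>\<D>. Sup k - Inf k) < \<delta> \<longrightarrow>
        (\<Sum>k\<in>\<D>. \<bar>Sup k - Inf k\<bar>) < e"
      using e eq by (intro exI[of _ e]) auto
  qed
  show ?thesis
    by (rule abs_continuous_on_dominated2[OF id id, where A = A and B = 0]) (use h in auto)
qed

lemma abs_continuous_on_imp_continuous_on:
  assumes f: "abs_continuous_on a b f"
  shows "continuous_on {a..b} f"
  unfolding continuous_on_iff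
proof (intro ballI allI impI)
  fix x and e :: real assume x: "x \<in> {a..b}" and "e > 0"
  obtain d where d: "d > 0"
    "\<forall>\<D> S. \<D> division_of S \<longrightarrow> S \<subseteq> {a..b} \<longrightarrow> (\<Sum>k\<in>\<D>. Sup k - Inf k) < d \<longrightarrow>
        (\<Sum>k\<in>\<D>. \<bar>f (Sup k) - f (Inf k)\<bar>) < e"
    using abs_continuous_onD[OF f \<open>e > 0\<close>] by blast
  have *: "\<bar>f v - f u\<bar> < e" if "u \<in> {a..b}" "v \<in> {a..b}" "u \<le> v" "v - u < d" for u v
    using d(2)[rule_format, of "{{u..v}}" "{u..v}"] that division_of_self[of u v] by auto
  show "\<exists>d>0. \<forall>x'\<in>{a..b}. dist x' x < d \<longrightarrow> dist (f x') (f x) < e"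
  proof (intro exI[of _ d] conjI ballI impI d(1))
    fix y assume "y \<in> {a..b}" "dist y x < d"
    then show "dist (f y) (f x) < e"
      using *[of x y] *[of y x] x by (cases "x \<le> y") (auto simp: dist_real_def abs_minus_commute)
  qed
qed

lemma abs_continuous_on_subinterval:
  assumes "abs_continuous_on a b f" "{c..d} \<subseteq> {a..b}"
  shows "abs_continuous_on c d f"
  using assms unfolding abs_continuous_on_def by (meson order_trans)

lemma continuous_on_interval_bounded:
  fixes f :: "real \<Rightarrow> real"
  assumes "continuous_on {a..b} f"
  obtains M where "M \<ge> 0" "\<And>x. x \<in> {a..b} \<Longrightarrow> \<bar>f x\<bar> \<le> M"
proof -
  have "bounded (f ` {a..b})"
    using assms by (intro compact_imp_bounded compact_continuous_image) auto
  then obtain M where "\<forall>y\<in>f ` {a..b}. norm y \<le> M" unfolding bounded_iff by blast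
  then show ?thesis by (intro that[of "max 0 M"]) force+
qed

lemma abs_continuous_on_mult:
  assumes f: "abs_continuous_on a b f" and g: "abs_continuous_on a b g"
  shows "abs_continuous_on a b (\<lambda>x. f x * g x)"
proof -
  obtain F where F: "F \<ge> 0" "\<And>x. x \<in> {a..b} \<Longrightarrow> \<bar>f x\<bar> \<le> F"
    using continuous_on_interval_bounded[OF abs_continuous_on_imp_continuous_on[OF f]] by metis
  obtain G where G: "G \<ge> 0" "\<And>x. x \<in> {a..b} \<Longrightarrow> \<bar>g x\<bar> \<le> G"
    using continuous_on_interval_bounded[OF abs_continuous_on_imp_continuous_on[OF g]] by metis
  show ?thesis
  proof (rule abs_continuous_on_dominated2[OF f g])
    fix x y assume xy: "x \<in> {a..b}" "y \<in> {a..b}"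
    have "f y * g y - f x * g x = g y * (f y - f x) + f x * (g y - g x)"
      by (simp add: algebra_simps)
    then have "\<bar>f y * g y - f x * g x\<bar> \<le> \<bar>g y\<bar> * \<bar>f y - f x\<bar> + \<bar>f x\<bar> * \<bar>g y - g x\<bar>"
      by (metis abs_mult abs_triangle_ineq)
    also have "\<dots> \<le> G * \<bar>f y - f x\<bar> + F * \<bar>g y - g x\<bar>"
      using F G xy by (intro add_mono mult_right_mono) auto
    finally show "\<bar>f y * g y - f x * g x\<bar> \<le> G * \<bar>f y - f x\<bar> + F * \<bar>g y - g x\<bar>" .
  qed
qed

lemma abs_continuous_on_diff:
  assumes "abs_continuous_on a b f" and "abs_continuous_on a b g"
  shows "abs_continuous_on a b (\<lambda>x. f x - g x)"
  by (rule abs_continuous_on_dominated2[OF assms, where A = 1 and B = 1]) auto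

text \<open>The definition of the Henstock--Kurzweil integral gives integrability of \<open>g\<close> and the value of the
  integral together. Change \<open>g\<close> to \<open>0\<close> on the null set \<open>N\<close>. Intervals of a fine tagged division whose tag is
  outside \<open>N\<close> are controlled by differentiability at the tag. For the intervals tagged in \<open>N\<close>, the
  fact that the indicator function of \<open>N\<close> has integral zero provides a gauge making their total
  length small, and absolute continuity then makes the total increment of \<open>f\<close> over them small.\<close>

lemma fundamental_theorem_of_calculus_abs_continuous:
  assumes ab: "a \<le> b" and f: "abs_continuous_on a b f" and N: "negligible N"
    and deriv: "\<And>x. x \<in> {a..b} - N \<Longrightarrow> (f has_real_derivative g x) (at x within {a..b})"
  shows "(g has_integral f b - f a) {a..b}"
proof -
  define g' where "g' x = (if x \<in> N then 0 else g x)" for x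
  have "(g' has_integral f b - f a) (cbox a b)"
    unfolding has_integral
  proof (intro allI impI)
    fix e :: real assume e: "e > 0"
    define e1 where "e1 = e / (2 * (b - a + 1))"
    have e1: "e1 > 0" "e1 * (b - a) \<le> e / 2"
      using e ab by (auto simp: e1_def field_simps)
    obtain \<delta> where \<delta>: "\<delta> > 0"
    "\<forall>\<D> S. \<D> division_of S \<longrightarrow> S \<subseteq> {a..b} \<longrightarrow> (\<Sum>k\<in>\<D>. Sup k - Inf k) < \<delta> \<longrightarrow>
        (\<Sum>k\<in>\<D>. \<bar>f (Sup k) - f (Inf k)\<bar>) < e / 2"
    using abs_continuous_onD[OF f half_gt_zero[OF e]] by blast
    have N0: "(indicator N has_integral (0::real)) (cbox a b)"
      using N by (simp add: negligible_def)
    obtain \<gamma>N where \<gamma>N: "gauge \<gamma>N" and small: "\<forall>\<D>. \<D> tagged_division_of cbox a b \<and> \<gamma>N fine \<D> \<longrightarrow>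
        norm ((\<Sum>(x,k)\<in>\<D>. measure lborel k *\<^sub>R indicator N x) - (0::real)) < \<delta>"
      using N0[unfolded has_integral, THEN spec, THEN mp, OF \<delta>(1)] by (elim exE conjE)
    have "\<exists>d. 0 < d \<and> (x \<in> {a..b} - N \<longrightarrow>
         (\<forall>y\<in>{a..b}. \<bar>y - x\<bar> < d \<longrightarrow> \<bar>f y - f x - g x * (y - x)\<bar> \<le> e1 * \<bar>y - x\<bar>))" for x
    proof (cases "x \<in> {a..b} - N")
      case True
      have "(f has_derivative (*) (g x)) (at x within {a..b})"
        using deriv[OF True] by (simp add: has_field_derivative_def)
      then have "\<forall>e>0. \<exists>d>0. \<forall>y\<in>{a..b}. \<bar>y - x\<bar> < d \<longrightarrow>
          \<bar>f y - f x - g x * (y - x)\<bar> \<le> e * \<bar>y - x\<bar>"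
        unfolding has_derivative_within_alt real_norm_def by (rule conjunct2)
      with e1(1) show ?thesis by blast
    qed (auto intro: exI[of _ 1])
    then have "\<exists>d. \<forall>x. 0 < d x \<and> (x \<in> {a..b} - N \<longrightarrow>
         (\<forall>y\<in>{a..b}. \<bar>y - x\<bar> < d x \<longrightarrow> \<bar>f y - f x - g x * (y - x)\<bar> \<le> e1 * \<bar>y - x\<bar>))"
      by (intro choice) blast
    then obtain d where d: "\<And>x. 0 < d x" and straddle: "\<And>x y. x \<in> {a..b} - N \<Longrightarrow> y \<in> {a..b} \<Longrightarrow>
        \<bar>y - x\<bar> < d x \<Longrightarrow> \<bar>f y - f x - g x * (y - x)\<bar> \<le> e1 * \<bar>y - x\<bar>"
      by blast
    show "\<exists>\<gamma>. gauge \<gamma> \<and> (\<forall>\<D>. \<D> tagged_division_of cbox a b \<and> \<gamma> fine \<D> \<longrightarrow>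
        norm ((\<Sum>(x,k)\<in>\<D>. measure lborel k *\<^sub>R g' x) - (f b - f a)) < e)"
    proof (intro exI[of _ "\<lambda>x. ball x (d x) \<inter> \<gamma>N x"] conjI allI impI; (elim conjE)?)
      show "gauge (\<lambda>x. ball x (d x) \<inter> \<gamma>N x)"
        using d \<gamma>N by (intro gauge_Int gauge_ball_dependent) auto
    next
      fix p assume p: "p tagged_division_of cbox a b" and fine: "(\<lambda>x. ball x (d x) \<inter> \<gamma>N x) fine p"
      note pD = tagged_division_ofD[OF p]
      have fin: "finite p" by (rule pD(1))
      have K: "\<exists>u v. k = {u..v} \<and> u \<le> v \<and> x \<in> {u..v} \<and> {u..v} \<subseteq> {a..b}"
        if xk: "(x, k) \<in> p" for x k
      proof -
        obtain u v where "k = cbox u v" using pD(4)[OF xk] by blast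
        then show ?thesis using pD(2,3)[OF xk] by (intro exI[of _ u] exI[of _ v]) auto
      qed
      have fba: "f b - f a = (\<Sum>(x,k)\<in>p. f (Sup k) - f (Inf k))"
        and ba: "b - a = (\<Sum>(x,k)\<in>p. Sup k - Inf k)"
        using additive_tagged_division_1[OF ab, of p f] additive_tagged_division_1[OF ab, of p "\<lambda>x. x"] p
        by auto
      define q where "q = {(x,k) \<in> p. x \<in> N}"
      define r where "r = {(x,k) \<in> p. x \<notin> N}"
      have pqr: "p = q \<union> r" "q \<inter> r = {}" "finite q" "finite r"
        using fin unfolding q_def r_def by (auto intro: finite_subset[OF _ fin])
      let ?E = "\<lambda>(x,k). measure lborel k * g' x - (f (Sup k) - f (Inf k))"
      have "(\<Sum>(x,k)\<in>p. measure lborel k *\<^sub>R g' x) - (f b - f a) = sum ?E p"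
        unfolding fba by (simp add: sum_subtractf split_def)
      also have "\<dots> = sum ?E q + sum ?E r"
        by (simp add: pqr sum.union_disjoint)
      finally have eq: "(\<Sum>(x,k)\<in>p. measure lborel k *\<^sub>R g' x) - (f b - f a) = sum ?E q + sum ?E r" .
      have "\<bar>sum ?E r\<bar> \<le> (\<Sum>(x,k)\<in>r. e1 * (Sup k - Inf k))"
      proof (rule order_trans[OF sum_abs], rule sum_mono, clarify)
        fix x k assume xk: "(x, k) \<in> r"
        then have xkp: "(x, k) \<in> p" and xN: "x \<notin> N" by (auto simp: r_def)
        obtain u v where k: "k = {u..v}" "u \<le> v" "x \<in> {u..v}" "{u..v} \<subseteq> {a..b}"
          using K[OF xkp] by blast
        have sub: "k \<subseteq> ball x (d x)" using fine xkp by (auto simp: fine_def)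
        have "u \<in> {u..v}" "v \<in> {u..v}" using k by auto
        then have "u \<in> {a..b}" "v \<in> {a..b}" "u \<in> ball x (d x)" "v \<in> ball x (d x)"
          using k(1,4) sub by blast+
        then have u: "u \<in> {a..b}" "\<bar>u - x\<bar> < d x" and v: "v \<in> {a..b}" "\<bar>v - x\<bar> < d x"
          by (auto simp: dist_real_def abs_minus_commute)
        have x: "x \<in> {a..b} - N" using k(3,4) xN by blast
        have "\<bar>(v - u) * g x - (f v - f u)\<bar> \<le> e1 * \<bar>v - x\<bar> + e1 * \<bar>u - x\<bar>"
        proof -
          have "(v - u) * g x - (f v - f u) = (f u - f x - g x * (u - x)) - (f v - f x - g x * (v - x))"
            by (simp add: algebra_simps)
          then show ?thesis using straddle[OF x u] straddle[OF x v] by linarith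
        qed
        also have "\<dots> = e1 * (v - u)" using k by (simp add: algebra_simps)
        finally show "\<bar>measure lborel k * g' x - (f (Sup k) - f (Inf k))\<bar> \<le> e1 * (Sup k - Inf k)"
          using k xN by (simp add: g'_def)
      qed
      also have "\<dots> \<le> (\<Sum>(x,k)\<in>p. e1 * (Sup k - Inf k))"
      proof (rule sum_mono2[OF fin])
        show "r \<subseteq> p" by (auto simp: r_def)
      next
        fix z assume "z \<in> p - r"
        then show "0 \<le> (case z of (x, k) \<Rightarrow> e1 * (Sup k - Inf k))"
          using K e1(1) by (cases z) fastforce
      qed
      also have "\<dots> = e1 * (b - a)" by (simp add: ba sum_distrib_left split_def)
      finally have r: "\<bar>sum ?E r\<bar> \<le> e / 2" using e1 by linarith
      have pq: "q tagged_partial_division_of cbox a b"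
        using p by (auto simp: q_def tagged_division_of_def intro: tagged_partial_division_subset)
      have qt: "q tagged_division_of \<Union>(snd ` q)"
        by (rule tagged_partial_division_of_Union_self[OF pq])
      have qab: "\<Union>(snd ` q) \<subseteq> {a..b}"
        using pD(3) unfolding q_def by fastforce
      \<comment> \<open>Different tags may carry the same degenerate interval, which contributes nothing.\<close>
      have len: "(\<Sum>k\<in>snd ` q. \<phi> (Sup k) (Inf k)) = (\<Sum>(x,k)\<in>q. \<phi> (Sup k) (Inf k))"
        if \<phi>: "\<And>z. \<phi> z z = 0" for \<phi> :: "real \<Rightarrow> real \<Rightarrow> real"
      proof -
        have "(\<Sum>k\<in>snd ` q. \<phi> (Sup k) (Inf k)) = (\<Sum>k\<in>snd ` q. if k = {} then 0 else \<phi> (Sup k) (Inf k))"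
          by (rule sum.cong) (use tagged_division_ofD(2)[OF qt] in fastforce)+
        also have "\<dots> = (\<Sum>(x,k)\<in>q. if k = {} then 0 else \<phi> (Sup k) (Inf k))"
        proof (rule sum.over_tagged_division_lemma[OF qt, symmetric])
          fix u v :: real assume "box u v = {}"
          then have "v \<le> u" by (simp add: box_real)
          then show "(if cbox u v = {} then 0 else \<phi> (Sup (cbox u v)) (Inf (cbox u v))) = 0"
            using \<phi> by (cases "u = v") (auto simp: box_real)
        qed
        also have "\<dots> = (\<Sum>(x,k)\<in>q. \<phi> (Sup k) (Inf k))"
          by (rule sum.cong) (use tagged_division_ofD(2)[OF qt] in fastforce)+
        finally show ?thesis .
      qed
      have "(\<Sum>k\<in>snd ` q. Sup k - Inf k) = (\<Sum>(x,k)\<in>q. Sup k - Inf k)"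
        by (rule len) simp
      also have "\<dots> = (\<Sum>(x,k)\<in>p. measure lborel k * indicator N x)"
      proof (rule sum.mono_neutral_cong_left[OF fin])
        show "q \<subseteq> p" by (auto simp: q_def)
        show "\<forall>z\<in>p - q. (case z of (x, k) \<Rightarrow> measure lborel k * indicator N x) = 0"
          by (auto simp: q_def indicator_def)
        fix z assume "z \<in> q"
        then obtain x k where z: "z = (x, k)" "(x, k) \<in> p" "x \<in> N" by (auto simp: q_def)
        with K[OF z(2)] show "(case z of (x, k) \<Rightarrow> Sup k - Inf k) = (case z of (x, k) \<Rightarrow> measure lborel k * indicator N x)"
          by auto
      qed
      also have "\<dots> < \<delta>"
        using small[rule_format, of p] p fine by (auto simp: fine_Int)
      finally have "(\<Sum>k\<in>snd ` q. \<bar>f (Sup k) - f (Inf k)\<bar>) < e / 2"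
        using \<delta>(2)[rule_format, OF partial_division_of_tagged_division[OF pq] qab] by simp
      then have "(\<Sum>(x,k)\<in>q. \<bar>f (Sup k) - f (Inf k)\<bar>) < e / 2"
        using len[of "\<lambda>x y. \<bar>f x - f y\<bar>"] by simp
      moreover have "\<bar>sum ?E q\<bar> \<le> (\<Sum>(x,k)\<in>q. \<bar>f (Sup k) - f (Inf k)\<bar>)"
        by (rule order_trans[OF sum_abs], rule sum_mono) (auto simp: q_def g'_def)
      ultimately show "norm ((\<Sum>(x,k)\<in>p. measure lborel k *\<^sub>R g' x) - (f b - f a)) < e"
        unfolding eq real_norm_def using r by linarith
    qed
  qed
  then show ?thesis
    unfolding box_real
    by (rule has_integral_spike[OF N, rotated]) (auto simp: g'_def)
qed

section \<open>The space \<open>W21\<close>\<close>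

lemma at_within_unit_interval_nontrivial: "t \<in> {0..1::real} \<Longrightarrow> at t within {0..1} \<noteq> bot"
  using islimpt_Icc[of 0 1 t] by (simp add: trivial_limit_within)

lemma D_eqI:
  assumes "t \<in> {0..1}" "(u has_real_derivative d) (at t within {0..1})"
  shows "D u t = d"
  unfolding D_def using assms
  by (intro vector_derivative_within at_within_unit_interval_nontrivial)
     (auto simp: has_real_derivative_iff_has_vector_derivative)

lemma has_real_derivative_D_iff:
  "(u has_real_derivative D u t) (at t within {0..1}) \<longleftrightarrow> u differentiable (at t within {0..1})"
  unfolding D_def has_real_derivative_iff_has_vector_derivative by (metis vector_derivative_works)

lemma has_real_derivative_congI:
  fixes f g :: "real \<Rightarrow> real"
  assumes "(f has_real_derivative d) (at t within {0..1})" "t \<in> {0..1}" "\<And>x. x \<in> {0..1} \<Longrightarrow> g x = f x"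
  shows "(g has_real_derivative d) (at t within {0..1})"
  using has_derivative_transform[OF assms(2,3) assms(1)[unfolded has_field_derivative_def]]
  by (simp add: has_field_derivative_def)

lemma W21_has_real_derivative:
  "u \<in> W21 \<Longrightarrow> t \<in> {0..1} \<Longrightarrow> (u has_real_derivative D u t) (at t within {0..1})"
  unfolding has_real_derivative_D_iff W21_def by auto

lemma W21_abs_continuous_on_D: "u \<in> W21 \<Longrightarrow> abs_continuous_on 0 1 (D u)"
  unfolding W21_def by auto

lemma W21_continuous_on: "u \<in> W21 \<Longrightarrow> continuous_on {0..1} u"
  by (rule DERIV_continuous_on[OF W21_has_real_derivative])

lemma W21_abs_continuous_on:
  assumes "u \<in> W21"
  shows "abs_continuous_on 0 1 u"
proof -
  obtain M where M: "\<And>x. x \<in> {0..1} \<Longrightarrow> \<bar>D u x\<bar> \<le> M"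
    using continuous_on_interval_bounded[OF abs_continuous_on_imp_continuous_on[OF W21_abs_continuous_on_D[OF assms]]]
    by metis
  show ?thesis
  proof (rule abs_continuous_on_lipschitz)
    fix x y :: real assume xy: "x \<in> {0..1}" "y \<in> {0..1}"
    have "norm (u y - u x) \<le> M * norm (y - x)"
      by (rule field_differentiable_bound[of "{0..1}" u "D u"])
         (use xy M W21_has_real_derivative[OF assms] in auto)
    then show "\<bar>u y - u x\<bar> \<le> M * \<bar>y - x\<bar>" by simp
  qed
qed

lemma
  assumes u: "u \<in> W21" and v: "v \<in> W21"
  shows W21_lincomb: "(\<lambda>t. \<alpha> * u t + \<beta> * v t) \<in> W21" (is "?w \<in> W21")
    and D_lincomb: "t \<in> {0..1} \<Longrightarrow> D (\<lambda>t. \<alpha> * u t + \<beta> * v t) t = \<alpha> * D u t + \<beta> * D v t"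
proof -
  have der: "(?w has_real_derivative \<alpha> * D u t + \<beta> * D v t) (at t within {0..1})" if "t \<in> {0..1}" for t
    using that by (auto intro!: derivative_eq_intros W21_has_real_derivative[OF u] W21_has_real_derivative[OF v])
  show D: "D ?w t = \<alpha> * D u t + \<beta> * D v t" if "t \<in> {0..1}" for t
    using D_eqI[OF that der[OF that]] .
  show "?w \<in> W21"
    unfolding W21_def
  proof (intro CollectI conjI ballI)
    fix t :: real assume "t \<in> {0..1}"
    then show "?w differentiable (at t within {0..1})"
      using der unfolding real_differentiable_def by blast
  next
    show "abs_continuous_on 0 1 (D ?w)"
    proof (rule abs_continuous_on_dominated2[OF W21_abs_continuous_on_D[OF u] W21_abs_continuous_on_D[OF v]])
      fix x y :: real assume "x \<in> {0..1}" "y \<in> {0..1}"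
      then have "D ?w y - D ?w x = \<alpha> * (D u y - D u x) + \<beta> * (D v y - D v x)"
        by (simp add: D algebra_simps)
      then show "\<bar>D ?w y - D ?w x\<bar> \<le> \<bar>\<alpha>\<bar> * \<bar>D u y - D u x\<bar> + \<bar>\<beta>\<bar> * \<bar>D v y - D v x\<bar>"
        by (metis abs_mult abs_triangle_ineq)
    qed
  qed
qed

lemma
  fixes \<alpha> \<beta> :: real
  shows W21_affine: "(\<lambda>t. \<alpha> + \<beta> * t) \<in> W21" (is "?l \<in> W21")
    and D_affine: "t \<in> {0..1} \<Longrightarrow> D (\<lambda>t. \<alpha> + \<beta> * t) t = \<beta>"
proof -
  have der: "(?l has_real_derivative \<beta>) (at t within {0..1})" for t
    by (auto intro!: derivative_eq_intros)
  show D: "D ?l t = \<beta>" if "t \<in> {0..1}" for t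
    using D_eqI[OF that der] .
  show "?l \<in> W21"
    unfolding W21_def
  proof (intro CollectI conjI ballI)
    show "?l differentiable (at t within {0..1})" for t
      using der unfolding real_differentiable_def by blast
    show "abs_continuous_on 0 1 (D ?l)"
      by (rule abs_continuous_on_lipschitz[where A = 0]) (simp add: D)
  qed
qed

section \<open>The differential equation and Green's identity\<close>

text \<open>The equation in the shape required by the fundamental theorem of calculus: the derivative of
  \<open>D u\<close> is prescribed off a null set.\<close>

lemma solves_iff_negligible:
  "solves a lam \<sigma> u \<longleftrightarrow> (\<exists>N. negligible N \<and>
     (\<forall>t\<in>{0..1} - N. (D u has_real_derivative \<sigma> t - (a t + lam) * u t) (at t within {0..1})))"
proof -
  have pt: "D u differentiable (at t within {0..1}) \<and> L a lam u t = \<sigma> t \<longleftrightarrow>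
      (D u has_real_derivative \<sigma> t - (a t + lam) * u t) (at t within {0..1})" if t: "t \<in> {0..1}" for t
  proof
    assume *: "D u differentiable (at t within {0..1}) \<and> L a lam u t = \<sigma> t"
    then have "(D u has_real_derivative D (D u) t) (at t within {0..1})"
      by (simp add: has_real_derivative_D_iff)
    then show "(D u has_real_derivative \<sigma> t - (a t + lam) * u t) (at t within {0..1})"
    proof -
      have "D (D u) t = \<sigma> t - (a t + lam) * u t" using * unfolding L_def by linarith
      with \<open>(D u has_real_derivative D (D u) t) (at t within {0..1})\<close> show ?thesis by simp
    qed
  next
    assume *: "(D u has_real_derivative \<sigma> t - (a t + lam) * u t) (at t within {0..1})"
    then show "D u differentiable (at t within {0..1}) \<and> L a lam u t = \<sigma> t"
      using D_eqI[OF t *] * unfolding real_differentiable_def by (auto simp: L_def)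
  qed
  have "solves a lam \<sigma> u \<longleftrightarrow> (AE t in lebesgue. t \<in> {0..1} \<longrightarrow>
      (D u has_real_derivative \<sigma> t - (a t + lam) * u t) (at t within {0..1}))"
    unfolding solves_def AE_completion_iff by (rule AE_cong) (use pt in auto)
  also have "\<dots> \<longleftrightarrow> (\<exists>N. negligible N \<and>
     (\<forall>t\<in>{0..1} - N. (D u has_real_derivative \<sigma> t - (a t + lam) * u t) (at t within {0..1})))"
    unfolding eventually_ae_filter negligible_iff_null_sets  Bex_def
    by (intro ex_cong1 conj_cong) auto
  finally show ?thesis .
qed

lemma solves_lincomb:
  assumes u: "u \<in> W21" "solves a lam \<sigma> u" and v: "v \<in> W21" "solves a lam \<tau> v"
  shows "solves a lam (\<lambda>t. \<alpha> * \<sigma> t + \<beta> * \<tau> t) (\<lambda>t. \<alpha> * u t + \<beta> * v t)"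
proof -
  obtain M where M: "negligible M"
    "\<And>t. t \<in> {0..1} - M \<Longrightarrow> (D u has_real_derivative \<sigma> t - (a t + lam) * u t) (at t within {0..1})"
    using u(2) unfolding solves_iff_negligible by blast
  obtain N where N: "negligible N"
    "\<And>t. t \<in> {0..1} - N \<Longrightarrow> (D v has_real_derivative \<tau> t - (a t + lam) * v t) (at t within {0..1})"
    using v(2) unfolding solves_iff_negligible by blast
  show ?thesis
    unfolding solves_iff_negligible
  proof (intro exI[of _ "M \<union> N"] conjI ballI)
    fix t assume t: "t \<in> {0..1} - (M \<union> N)"
    then have "((\<lambda>t. \<alpha> * D u t + \<beta> * D v t) has_real_derivative
        \<alpha> * (\<sigma> t - (a t + lam) * u t) + \<beta> * (\<tau> t - (a t + lam) * v t)) (at t within {0..1})"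
      using M(2)[of t] N(2)[of t] by (auto intro!: derivative_eq_intros)
    then have "(D (\<lambda>t. \<alpha> * u t + \<beta> * v t) has_real_derivative
        \<alpha> * (\<sigma> t - (a t + lam) * u t) + \<beta> * (\<tau> t - (a t + lam) * v t)) (at t within {0..1})"
      by (rule has_real_derivative_congI) (use t D_lincomb[OF u(1) v(1)] in auto)
    then show "(D (\<lambda>t. \<alpha> * u t + \<beta> * v t) has_real_derivative
        \<alpha> * \<sigma> t + \<beta> * \<tau> t - (a t + lam) * (\<alpha> * u t + \<beta> * v t)) (at t within {0..1})"
      by (simp add: algebra_simps)
  qed (use M(1) N(1) in auto)
qed

lemma solves_affine:
  "solves a lam (\<lambda>t. (a t + lam) * (\<alpha> + \<beta> * t)) (\<lambda>t. \<alpha> + \<beta> * t)"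
  unfolding solves_iff_negligible
proof (intro exI[of _ "{}"] conjI ballI)
  fix t :: real assume "t \<in> {0..1} - {}"
  then have "(D (\<lambda>t. \<alpha> + \<beta> * t) has_real_derivative 0) (at t within {0..1})"
    by (intro has_real_derivative_congI[OF DERIV_const[of \<beta>]] D_affine) auto
  then show "(D (\<lambda>t. \<alpha> + \<beta> * t) has_real_derivative
      (a t + lam) * (\<alpha> + \<beta> * t) - (a t + lam) * (\<alpha> + \<beta> * t)) (at t within {0..1})"
    by simp
qed auto

lemma solves_D_has_integral:
  assumes u: "u \<in> W21" "solves a lam \<sigma> u" and cd: "0 \<le> c" "c \<le> d" "d \<le> 1"
  shows "((\<lambda>t. \<sigma> t - (a t + lam) * u t) has_integral D u d - D u c) {c..d}"
proof -
  have sub: "{c..d} \<subseteq> {0..1}" using cd by auto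
  obtain N where N: "negligible N"
    "\<And>t. t \<in> {0..1} - N \<Longrightarrow> (D u has_real_derivative \<sigma> t - (a t + lam) * u t) (at t within {0..1})"
    using u(2) unfolding solves_iff_negligible by blast
  show ?thesis
  proof (rule fundamental_theorem_of_calculus_abs_continuous[OF cd(2) _ N(1)])
    show "abs_continuous_on c d (D u)"
      by (rule abs_continuous_on_subinterval[OF W21_abs_continuous_on_D[OF u(1)] sub])
    fix t assume "t \<in> {c..d} - N"
    then have "t \<in> {0..1} - N" using sub by blast
    from N(2)[OF this] show "(D u has_real_derivative \<sigma> t - (a t + lam) * u t) (at t within {c..d})"
      by (rule DERIV_subset[OF _ sub])
  qed
qed

text \<open>The derivative of \<open>v u' - v' u\<close> is \<open>v u'' - v'' u\<close>, in which the two terms containing the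
  potential cancel.\<close>

lemma greens_identity:
  assumes v: "v \<in> W21" "solves a lam (\<lambda>_. 0) v" and u: "u \<in> W21" "solves a lam \<sigma> u"
    and cd: "0 \<le> c" "c \<le> d" "d \<le> 1"
  shows "((\<lambda>t. v t * \<sigma> t) has_integral
           (v d * D u d - D v d * u d) - (v c * D u c - D v c * u c)) {c..d}"
proof -
  have sub: "{c..d} \<subseteq> {0..1}" using cd by auto
  obtain M where M: "negligible M"
    "\<And>t. t \<in> {0..1} - M \<Longrightarrow> (D u has_real_derivative \<sigma> t - (a t + lam) * u t) (at t within {0..1})"
    using u(2) unfolding solves_iff_negligible by blast
  obtain N where N: "negligible N"
    "\<And>t. t \<in> {0..1} - N \<Longrightarrow> (D v has_real_derivative 0 - (a t + lam) * v t) (at t within {0..1})"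
    using v(2) unfolding solves_iff_negligible by blast
  have ac: "abs_continuous_on 0 1 (\<lambda>t. v t * D u t - D v t * u t)"
    using u(1) v(1)
    by (intro abs_continuous_on_diff abs_continuous_on_mult W21_abs_continuous_on W21_abs_continuous_on_D)
  show ?thesis
  proof (rule fundamental_theorem_of_calculus_abs_continuous[OF cd(2) abs_continuous_on_subinterval[OF ac sub]])
    show "negligible (M \<union> N)" using M(1) N(1) by auto
    fix t assume "t \<in> {c..d} - (M \<union> N)"
    then have t: "t \<in> {0..1}" "t \<in> {0..1} - M" "t \<in> {0..1} - N" using sub by blast+
    have "((\<lambda>t. v t * D u t - D v t * u t) has_real_derivative v t * \<sigma> t) (at t within {0..1})"
      using M(2)[OF t(2)] N(2)[OF t(3)] W21_has_real_derivative[OF u(1) t(1)] W21_has_real_derivative[OF v(1) t(1)]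
      by (auto intro!: derivative_eq_intros simp: algebra_simps)
    then show "((\<lambda>t. v t * D u t - D v t * u t) has_real_derivative v t * \<sigma> t) (at t within {c..d})"
      by (rule DERIV_subset[OF _ sub])
  qed
qed

section \<open>Integral kernels\<close>

lemma absolutely_integrable_continuous_mult:
  fixes f g :: "real \<Rightarrow> real"
  assumes "continuous_on {a..b} f" "g absolutely_integrable_on {a..b}"
  shows "(\<lambda>x. f x * g x) absolutely_integrable_on {a..b}"
  using assms
  by (intro absolutely_integrable_bounded_measurable_product_real continuous_imp_measurable_on_sets_lebesgue
        compact_imp_bounded compact_continuous_image) auto

text \<open>Test with \<open>\<sigma> = k\<close>: a nonnegative continuous function with integral zero vanishes.\<close>

lemma kernel_eq_0:
  fixes k :: "real \<Rightarrow> real"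
  assumes k: "continuous_on {a..b} k" and ab: "a < b"
    and int: "\<And>\<sigma>. \<sigma> absolutely_integrable_on {a..b} \<Longrightarrow> ((\<lambda>s. k s * \<sigma> s) has_integral 0) {a..b}"
    and s: "s \<in> {a..b}"
  shows "k s = 0"
proof -
  have "((\<lambda>s. k s * k s) has_integral 0) (cbox a b)"
    using int[OF absolutely_integrable_continuous_real[OF k]] by simp
  then have "k s * k s = 0"
    by (rule has_integral_0_cbox_imp_0[rotated 2]) (use k ab s in \<open>auto intro!: continuous_intros\<close>)
  then show ?thesis by simp
qed

section \<open>Uniqueness for the initial value problem\<close>

lemma
  fixes a :: "real \<Rightarrow> real"
  assumes a: "a absolutely_integrable_on {0..1}"
  shows absolutely_integrable_potential: "(\<lambda>t. a t + lam) absolutely_integrable_on {0..1}"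
    and integrable_abs_potential: "(\<lambda>t. \<bar>a t + lam\<bar>) integrable_on {0..1}"
proof -
  have "(\<lambda>t::real. lam) absolutely_integrable_on {0..1}"
    by (intro absolutely_integrable_continuous_real continuous_on_const)
  with a show *: "(\<lambda>t. a t + lam) absolutely_integrable_on {0..1}"
    by (rule set_integral_add)
  then show "(\<lambda>t. \<bar>a t + lam\<bar>) integrable_on {0..1}"
    by (simp add: absolutely_integrable_on_def)
qed

text \<open>On an interval where the potential has mass at most \<open>1/2\<close>, integrating the equation bounds \<open>v'\<close>, and
  then \<open>v\<close>, by half the maximum of \<open>\<bar>v\<bar>\<close>; hence that maximum is zero.\<close>

lemma solution_zero_step:
  assumes a: "a absolutely_integrable_on {0..1}" and v: "v \<in> W21" "solves a lam (\<lambda>_. 0) v"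
    and cd: "0 \<le> c" "c \<le> d" "d \<le> 1" and init: "v c = 0" "D v c = 0"
    and small: "integral {c..d} (\<lambda>t. \<bar>a t + lam\<bar>) \<le> 1 / 2"
  shows "v d = 0" "D v d = 0"
proof -
  have sub: "{c..d} \<subseteq> {0..1}" using cd by auto
  have absb: "(\<lambda>t. \<bar>a t + lam\<bar>) integrable_on {x..y}" if "{x..y} \<subseteq> {0..1}" for x y
    by (rule integrable_on_subinterval[OF integrable_abs_potential[OF a] that])
  have "continuous_on {c..d} (\<lambda>t. \<bar>v t\<bar>)"
    by (intro continuous_intros continuous_on_subset[OF W21_continuous_on[OF v(1)] sub])
  then obtain m where m: "m \<in> {c..d}" "\<And>t. t \<in> {c..d} \<Longrightarrow> \<bar>v t\<bar> \<le> \<bar>v m\<bar>"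
    using continuous_attains_sup[of "{c..d}" "\<lambda>t. \<bar>v t\<bar>"] cd by auto
  have Dv: "\<bar>D v t\<bar> \<le> \<bar>v m\<bar> / 2" if t: "t \<in> {c..d}" for t
  proof -
    have ct: "{c..t} \<subseteq> {c..d}" "{c..t} \<subseteq> {0..1}" using t cd by auto
    have I: "((\<lambda>t. 0 - (a t + lam) * v t) has_integral D v t - D v c) {c..t}"
      by (rule solves_D_has_integral[OF v]) (use t cd in auto)
    have J: "(\<lambda>t. \<bar>v m\<bar> * \<bar>a t + lam\<bar>) integrable_on {c..t}"
      by (intro integrable_on_mult_right absb ct)
    have "norm (integral {c..t} (\<lambda>t. 0 - (a t + lam) * v t)) \<le> integral {c..t} (\<lambda>t. \<bar>v m\<bar> * \<bar>a t + lam\<bar>)"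
    proof (rule integral_norm_bound_integral[OF has_integral_integrable[OF I] J])
      fix s assume "s \<in> {c..t}"
      then have "\<bar>v s\<bar> \<le> \<bar>v m\<bar>" using m(2) ct by blast
      then show "norm (0 - (a s + lam) * v s) \<le> \<bar>v m\<bar> * \<bar>a s + lam\<bar>"
        by (simp add: abs_mult mult.commute[of _ "\<bar>a s + lam\<bar>"] mult_left_mono)
    qed
    also have "\<dots> = \<bar>v m\<bar> * integral {c..t} (\<lambda>t. \<bar>a t + lam\<bar>)" by simp
    also have "\<dots> \<le> \<bar>v m\<bar> * (1 / 2)"
    proof (rule mult_left_mono)
      have "integral {c..t} (\<lambda>t. \<bar>a t + lam\<bar>) \<le> integral {c..d} (\<lambda>t. \<bar>a t + lam\<bar>)"
        by (rule integral_subset_le[OF ct(1) absb[OF ct(2)] absb[OF sub]]) auto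
      then show "integral {c..t} (\<lambda>t. \<bar>a t + lam\<bar>) \<le> 1 / 2" using small by linarith
    qed auto
    finally show ?thesis using integral_unique[OF I] init by simp
  qed
  have "norm (v m - v c) \<le> \<bar>v m\<bar> / 2 * norm (m - c)"
  proof (rule field_differentiable_bound[of "{c..d}" v "D v"])
    show "(v has_real_derivative D v t) (at t within {c..d})" if "t \<in> {c..d}" for t
      by (rule DERIV_subset[OF W21_has_real_derivative[OF v(1)] sub]) (use that sub in blast)
  qed (use Dv m cd in auto)
  also have "\<dots> \<le> \<bar>v m\<bar> / 2 * 1" using m cd by (intro mult_left_mono) auto
  finally have "v m = 0" using init by simp
  then show "v d = 0" "D v d = 0" using m(2)[of d] Dv[of d] cd by auto
qed

text \<open>The primitive \<open>B\<close> of the potential's absolute value is uniformly continuous, so steps of a fixed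
  length carry the initial data across the whole interval.\<close>

lemma solution_zero_initial_data:
  assumes a: "a absolutely_integrable_on {0..1}" and v: "v \<in> W21" "solves a lam (\<lambda>_. 0) v"
    and init: "v 0 = 0" "D v 0 = 0" and t: "t \<in> {0..1}"
  shows "v t = 0"
proof -
  let ?b = "\<lambda>t. \<bar>a t + lam\<bar>"
  define B where "B t = integral {0..t} ?b" for t
  have b: "?b integrable_on {0..1}" by (rule integrable_abs_potential[OF a])
  have "continuous_on {0..1} B"
    unfolding B_def by (rule indefinite_integral_continuous_1[OF b])
  then have "uniformly_continuous_on {0..1} B"
    by (rule compact_uniformly_continuous) auto
  then obtain \<delta> where \<delta>: "\<delta> > 0" "\<And>x y. x \<in> {0..1} \<Longrightarrow> y \<in> {0..1} \<Longrightarrow> \<bar>y - x\<bar> < \<delta> \<Longrightarrow> \<bar>B y - B x\<bar> < 1 / 2"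
    unfolding uniformly_continuous_on_def dist_real_def by (meson half_gt_zero zero_less_one)
  have "\<forall>t\<in>{0..1}. t \<le> real n * (\<delta> / 2) \<longrightarrow> v t = 0 \<and> D v t = 0" for n
  proof (induction n)
    case 0
    then show ?case using init by auto
  next
    case (Suc n)
    show ?case
    proof (intro ballI impI)
      fix t :: real assume t: "t \<in> {0..1}" "t \<le> real (Suc n) * (\<delta> / 2)"
      define c where "c = min t (real n * (\<delta> / 2))"
      have c: "0 \<le> c" "c \<le> t" "t \<le> 1" "c \<in> {0..1}" "\<bar>t - c\<bar> < \<delta>"
        using t \<delta>(1) by (auto simp: c_def algebra_simps min_def)
      have "v c = 0" "D v c = 0" using Suc.IH c(4) by (auto simp: c_def)
      moreover have "integral {c..t} ?b \<le> 1 / 2"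
      proof -
        have "B c + integral {c..t} ?b = B t"
          unfolding B_def by (rule Henstock_Kurzweil_Integration.integral_combine[OF c(1,2)])
            (use c in \<open>auto intro: integrable_on_subinterval[OF b]\<close>)
        then show ?thesis using \<delta>(2)[OF c(4) t(1) c(5)] by linarith
      qed
      ultimately show "v t = 0 \<and> D v t = 0"
        using solution_zero_step[OF a v c(1,2,3)] by blast
    qed
  qed
  moreover obtain n where "t \<le> real n * (\<delta> / 2)"
    using reals_Archimedean3[of "\<delta> / 2"] \<delta>(1) by (metis half_gt_zero less_imp_le)
  ultimately show ?thesis using t by blast
qed

section \<open>The Dirichlet Green's function\<close>

lemma greens_function_continuous_on:
  assumes G: "is_greens_function a lam X G" and t: "t \<in> {0..1}"
  shows "continuous_on {0..1} (G t)"
proof -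
  have "continuous_on ({0..1} \<times> {0..1}) (\<lambda>(t, s). G t s)"
    using G by (simp add: is_greens_function_def)
  moreover have "continuous_on {0..1} (\<lambda>s. (t, s))"
    by (intro continuous_on_Pair continuous_on_const continuous_on_id)
  ultimately have "continuous_on {0..1} (\<lambda>s. case (t, s) of (t, s) \<Rightarrow> G t s)"
    by (rule continuous_on_compose2) (use t in auto)
  then show ?thesis by simp
qed

lemma greens_function_has_integral:
  assumes G: "is_greens_function a lam X G" and \<sigma>: "\<sigma> absolutely_integrable_on {0..1}" and t: "t \<in> {0..1}"
  shows "((\<lambda>s. G t s * \<sigma> s) has_integral (LINT s:{0..1}|lebesgue. G t s * \<sigma> s)) {0..1}"
  using absolutely_integrable_continuous_mult[OF greens_function_continuous_on[OF G t] \<sigma>]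
  by (rule has_integral_set_lebesgue)

text \<open>Subtract from the affine interpolant of the boundary values the Dirichlet solution with the same
  image under \<open>L[lam]\<close>.\<close>

lemma homogeneous_solution_boundary_values:
  assumes a: "a absolutely_integrable_on {0..1}" and G: "is_greens_function a lam X_Dirichlet G"
  obtains v where "v \<in> W21" "solves a lam (\<lambda>_. 0) v" "v 0 = \<alpha>" "v 1 = \<beta>"
proof -
  let ?l = "\<lambda>t. \<alpha> + (\<beta> - \<alpha>) * t"
  define \<sigma> where "\<sigma> t = (a t + lam) * ?l t" for t
  define u where "u t = (LINT s:{0..1}|lebesgue. G t s * \<sigma> s)" for t
  have "(\<lambda>t. ?l t * (a t + lam)) absolutely_integrable_on {0..1}"
    by (intro absolutely_integrable_continuous_mult absolutely_integrable_potential a continuous_intros)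
  also have "(\<lambda>t. ?l t * (a t + lam)) = \<sigma>"
    by (simp add: fun_eq_iff \<sigma>_def mult.commute)
  finally have "\<sigma> absolutely_integrable_on {0..1}" .
  then have u: "u \<in> X_Dirichlet" "solves a lam \<sigma> u"
    using G unfolding is_greens_function_def u_def by blast+
  then have u': "u \<in> W21" "u 0 = 0" "u 1 = 0" by (auto simp: X_Dirichlet_def)
  have l: "solves a lam \<sigma> ?l" unfolding \<sigma>_def by (rule solves_affine)
  have "(\<lambda>t. 1 * ?l t + (-1) * u t) \<in> W21"
    by (rule W21_lincomb[OF W21_affine u'(1)])
  moreover have "solves a lam (\<lambda>_. 0) (\<lambda>t. 1 * ?l t + (-1) * u t)"
    using solves_lincomb[OF W21_affine l u'(1) u(2), of 1 "-1"] by simp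
  ultimately show ?thesis by (rule that) (use u' in auto)
qed

text \<open>The continuous function \<open>h\<close> identifies the limits that define \<open>dt\<close> at \<open>s = 0\<close> and \<open>s = 1\<close>.\<close>

lemma dt_eqI:
  assumes h: "continuous_on {0..1} h" and eq: "\<And>s. s \<in> {0<..<1} \<Longrightarrow> D (\<lambda>\<tau>. G \<tau> s) t = h s"
    and s: "s \<in> {0..1}"
  shows "dt G t s = h s"
proof (cases "s \<in> {0<..<1}")
  case True
  then show ?thesis using eq by (simp add: dt_def)
next
  case False
  have "(h \<longlongrightarrow> h s) (at s within {0..1})"
    using h s by (simp add: continuous_on_def)
  then have "(h \<longlongrightarrow> h s) (at s within {0<..<1})"
    by (rule tendsto_within_subset) auto
  then have "((\<lambda>x. D (\<lambda>\<tau>. G \<tau> x) t) \<longlongrightarrow> h s) (at s within {0<..<1})"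
    by (rule Lim_transform_eventually) (auto simp: eventually_at_filter eq)
  moreover have "at s within {0<..<1} \<noteq> bot"
    using s False islimpt_greaterThanLessThan1[of 0 "1::real"] islimpt_greaterThanLessThan2[of 0 "1::real"]
    by (auto simp: trivial_limit_within not_less less_eq_real_def)
  ultimately show ?thesis
    unfolding dt_def if_not_P[OF False] by (intro tendsto_Lim)
qed

text \<open>The number \<open>D v1 0\<close> is the Wronskian of \<open>v0\<close> and \<open>v1\<close>, which is constant by Green's identity with
  \<open>\<sigma> = 0\<close>. Eliminating \<open>u' t\<close> from Green's identities for \<open>v1\<close> on \<open>{0..t}\<close> and for \<open>v0\<close> on
  \<open>{t..1}\<close> expresses the Wronskian times \<open>u t\<close> as an integral against \<open>\<sigma>\<close>; as \<open>\<sigma>\<close> is arbitrary,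
  its kernel must be that of \<open>u\<close>.\<close>

lemma dirichlet_greens_function:
  assumes a: "a absolutely_integrable_on {0..1}" and G: "is_greens_function a lam X_Dirichlet G"
    and v0: "v0 \<in> W21" "solves a lam (\<lambda>_. 0) v0" "v0 0 = 1" "v0 1 = 0"
    and v1: "v1 \<in> W21" "solves a lam (\<lambda>_. 0) v1" "v1 0 = 0" "v1 1 = 1"
  shows "D v1 0 \<noteq> 0" "D v0 1 = - D v1 0"
    and "t \<in> {0..1} \<Longrightarrow> s \<in> {0..1} \<Longrightarrow> G t s = - (v1 (min s t) * v0 (max s t)) / D v1 0"
proof -
  show W: "D v1 0 \<noteq> 0"
    using solution_zero_initial_data[OF a v1(1,2,3), of 1] v1(4) by auto
  have wronskian: "v0 t * D v1 t - D v0 t * v1 t = D v1 0" if "t \<in> {0..1}" for t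
  proof -
    \<comment> \<open>Green's identity with \<open>u = v1\<close> and \<open>\<sigma> = 0\<close>.\<close>
    have "((\<lambda>t. v0 t * 0) has_integral (v0 t * D v1 t - D v0 t * v1 t) - (v0 0 * D v1 0 - D v0 0 * v1 0)) {0..t}"
      by (rule greens_identity[OF v0(1,2) v1(1,2)]) (use that in auto)
    then have "(v0 t * D v1 t - D v0 t * v1 t) - (v0 0 * D v1 0 - D v0 0 * v1 0) = 0"
      unfolding mult_zero_right by (rule has_integral_unique[OF _ has_integral_0])
    then show ?thesis using v0 v1 by simp
  qed
  show "D v0 1 = - D v1 0" using wronskian[of 1] v0 v1 by simp
  assume t: "t \<in> {0..1}" and s: "s \<in> {0..1}"
  let ?k = "\<lambda>s. D v1 0 * G t s + v1 (min s t) * v0 (max s t)"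
  have "?k s = 0"
  proof (rule kernel_eq_0[OF _ _ _ s])
    show "continuous_on {0..1} ?k"
      using t by (intro continuous_intros greens_function_continuous_on[OF G]
          continuous_on_compose2[OF W21_continuous_on[OF v0(1)]]
          continuous_on_compose2[OF W21_continuous_on[OF v1(1)]]) auto
  next
    fix \<sigma> :: "real \<Rightarrow> real" assume \<sigma>: "\<sigma> absolutely_integrable_on {0..1}"
    define u where "u t = (LINT s:{0..1}|lebesgue. G t s * \<sigma> s)" for t
    have "u \<in> X_Dirichlet" "solves a lam \<sigma> u"
      using G \<sigma> unfolding is_greens_function_def u_def by blast+
    then have u: "u \<in> W21" "solves a lam \<sigma> u" "u 0 = 0" "u 1 = 0" by (auto simp: X_Dirichlet_def)
    have "((\<lambda>s. v1 s * \<sigma> s) has_integral (v1 t * D u t - D v1 t * u t) - (v1 0 * D u 0 - D v1 0 * u 0)) {0..t}"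
      by (rule greens_identity[OF v1(1,2) u(1,2)]) (use t in auto)
    then have "((\<lambda>s. v1 s * \<sigma> s) has_integral v1 t * D u t - D v1 t * u t) {0..t}"
      using u v1 by simp
    then have "((\<lambda>s. v0 t * (v1 s * \<sigma> s)) has_integral v0 t * (v1 t * D u t - D v1 t * u t)) {0..t}"
      by (rule has_integral_mult_right)
    then have left: "((\<lambda>s. v1 (min s t) * v0 (max s t) * \<sigma> s) has_integral v0 t * (v1 t * D u t - D v1 t * u t)) {0..t}"
      by (rule has_integral_eq[rotated]) (auto simp: min_def max_def)
    have "((\<lambda>s. v0 s * \<sigma> s) has_integral (v0 1 * D u 1 - D v0 1 * u 1) - (v0 t * D u t - D v0 t * u t)) {t..1}"
      by (rule greens_identity[OF v0(1,2) u(1,2)]) (use t in auto)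
    then have "((\<lambda>s. v0 s * \<sigma> s) has_integral D v0 t * u t - v0 t * D u t) {t..1}"
      using u v0 by simp
    then have "((\<lambda>s. v1 t * (v0 s * \<sigma> s)) has_integral v1 t * (D v0 t * u t - v0 t * D u t)) {t..1}"
      by (rule has_integral_mult_right)
    then have right: "((\<lambda>s. v1 (min s t) * v0 (max s t) * \<sigma> s) has_integral v1 t * (D v0 t * u t - v0 t * D u t)) {t..1}"
      by (rule has_integral_eq[rotated]) (auto simp: min_def max_def)
    have "((\<lambda>s. v1 (min s t) * v0 (max s t) * \<sigma> s) has_integral
        v0 t * (v1 t * D u t - D v1 t * u t) + v1 t * (D v0 t * u t - v0 t * D u t)) {0..1}"
      by (rule has_integral_combine[OF _ _ left right]) (use t in auto)
    also have "v0 t * (v1 t * D u t - D v1 t * u t) + v1 t * (D v0 t * u t - v0 t * D u t)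
        = - (v0 t * D v1 t - D v0 t * v1 t) * u t"
      by (simp add: algebra_simps)
    finally have "((\<lambda>s. v1 (min s t) * v0 (max s t) * \<sigma> s) has_integral - D v1 0 * u t) {0..1}"
      unfolding wronskian[OF t] .
    from has_integral_add[OF has_integral_mult_right[OF greens_function_has_integral[OF G \<sigma> t], of "D v1 0"] this]
    show "((\<lambda>s. ?k s * \<sigma> s) has_integral 0) {0..1}"
      by (simp add: u_def algebra_simps)
  qed simp
  then show "G t s = - (v1 (min s t) * v0 (max s t)) / D v1 0"
    using W by (simp add: field_simps)
qed

text \<open>For \<open>s\<close> in the open interval, \<open>G t s\<close> is a constant multiple of \<open>v1 t\<close> for \<open>t\<close> near \<open>0\<close> and of \<open>v0 t\<close>
  for \<open>t\<close> near \<open>1\<close>; the Wronskian cancels in the derivative.\<close>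

lemma dirichlet_greens_function_dt:
  assumes a: "a absolutely_integrable_on {0..1}" and G: "is_greens_function a lam X_Dirichlet G"
    and v0: "v0 \<in> W21" "solves a lam (\<lambda>_. 0) v0" "v0 0 = 1" "v0 1 = 0"
    and v1: "v1 \<in> W21" "solves a lam (\<lambda>_. 0) v1" "v1 0 = 0" "v1 1 = 1"
    and s: "s \<in> {0..1}"
  shows "dt G 0 s = - v0 s" "dt G 1 s = v1 s"
proof -
  note K = dirichlet_greens_function[OF a G v0 v1]
  show "dt G 0 s = - v0 s"
  proof (rule dt_eqI[OF _ _ s])
    show "continuous_on {0..1} (\<lambda>s. - v0 s)"
      by (intro continuous_intros W21_continuous_on v0)
    fix s :: real assume s: "s \<in> {0<..<1}"
    have "((\<lambda>\<tau>. - v0 s / D v1 0 * v1 \<tau>) has_real_derivative - v0 s / D v1 0 * D v1 0) (at 0 within {0..1})"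
      by (intro DERIV_cmult W21_has_real_derivative v1) simp
    then have "((\<lambda>\<tau>. G \<tau> s) has_real_derivative - v0 s / D v1 0 * D v1 0) (at 0 within {0..1})"
    proof (rule has_field_derivative_transform_within)
      show "0 < s" "0 \<in> {0..1::real}" using s by auto
      fix \<tau> :: real assume \<tau>: "\<tau> \<in> {0..1}" "dist \<tau> 0 < s"
      then have "min s \<tau> = \<tau>" "max s \<tau> = s" by auto
      then show "- v0 s / D v1 0 * v1 \<tau> = G \<tau> s"
        using K(3)[OF \<tau>(1), of s] s by simp
    qed
    then show "D (\<lambda>\<tau>. G \<tau> s) 0 = - v0 s"
      using K(1) by (simp add: D_eqI)
  qed
  show "dt G 1 s = v1 s"
  proof (rule dt_eqI[OF _ _ s])
    show "continuous_on {0..1} v1"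
      by (intro continuous_intros W21_continuous_on v1)
    fix s :: real assume s: "s \<in> {0<..<1}"
    have "((\<lambda>\<tau>. - v1 s / D v1 0 * v0 \<tau>) has_real_derivative - v1 s / D v1 0 * D v0 1) (at 1 within {0..1})"
      by (intro DERIV_cmult W21_has_real_derivative v0) simp
    then have "((\<lambda>\<tau>. G \<tau> s) has_real_derivative - v1 s / D v1 0 * D v0 1) (at 1 within {0..1})"
    proof (rule has_field_derivative_transform_within)
      show "0 < 1 - s" "1 \<in> {0..1::real}" using s by auto
      fix \<tau> :: real assume \<tau>: "\<tau> \<in> {0..1}" "dist \<tau> 1 < 1 - s"
      then have "min s \<tau> = s" "max s \<tau> = \<tau>" by (auto simp: dist_real_def)
      then show "- v1 s / D v1 0 * v0 \<tau> = G \<tau> s"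
        using K(3)[OF \<tau>(1), of s] s by simp
    qed
    then show "D (\<lambda>\<tau>. G \<tau> s) 1 = v1 s"
      using K(1,2) by (simp add: D_eqI)
  qed
qed

section \<open>Comparison of the Dirichlet and the periodic Green's functions\<close>

text \<open>Adding the multiple \<open>D u 0 - D u 1\<close> of \<open>r\<close> to the periodic solution gives the Dirichlet solution
  \<open>u\<close>, and Green's identity on \<open>{0..1}\<close> turns this multiple into \<open>- \<integral> (v0 + v1) \<sigma>\<close>.\<close>

lemma dirichlet_periodic_kernel:
  assumes per: "nonresonant a lam X_periodic"
    and GD: "is_greens_function a lam X_Dirichlet G_D" and GP: "is_greens_function a lam X_periodic G_P"
    and r: "is_r4 a lam r"
    and v0: "v0 \<in> W21" "solves a lam (\<lambda>_. 0) v0" "v0 0 = 1" "v0 1 = 0"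
    and v1: "v1 \<in> W21" "solves a lam (\<lambda>_. 0) v1" "v1 0 = 0" "v1 1 = 1"
    and t: "t \<in> {0..1}" and s: "s \<in> {0..1}"
  shows "G_D t s = G_P t s - r t * (v0 s + v1 s)"
proof -
  let ?k = "\<lambda>s. G_D t s - G_P t s + r t * (v0 s + v1 s)"
  have "?k s = 0"
  proof (rule kernel_eq_0[OF _ _ _ s])
    show "continuous_on {0..1} ?k"
      by (intro continuous_intros greens_function_continuous_on[OF GD t] greens_function_continuous_on[OF GP t]
          W21_continuous_on v0 v1)
  next
    fix \<sigma> :: "real \<Rightarrow> real" assume \<sigma>: "\<sigma> absolutely_integrable_on {0..1}"
    define u where "u t = (LINT s:{0..1}|lebesgue. G_D t s * \<sigma> s)" for t
    define p where "p t = (LINT s:{0..1}|lebesgue. G_P t s * \<sigma> s)" for t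
    have "u \<in> X_Dirichlet" "solves a lam \<sigma> u"
      using GD \<sigma> unfolding is_greens_function_def u_def by blast+
    then have u: "u \<in> W21" "solves a lam \<sigma> u" "u 0 = 0" "u 1 = 0" by (auto simp: X_Dirichlet_def)
    have "p \<in> X_periodic" "solves a lam \<sigma> p"
      using GP \<sigma> unfolding is_greens_function_def p_def by blast+
    then have p: "p \<in> W21" "solves a lam \<sigma> p" "p 0 = p 1" "D p 0 = D p 1" by (auto simp: X_periodic_def)
    have r: "r \<in> W21" "solves a lam (\<lambda>_. 0) r" "r 0 = r 1" "D r 0 = D r 1 + 1"
      using r by (auto simp: is_r4_def)
    define c where "c = D u 0 - D u 1"
    define w where "w t = 1 * u t + (-1) * p t" for t
    \<comment> \<open>The jump of \<open>w'\<close> across the period is \<open>c\<close>, that of \<open>r'\<close> is \<open>1\<close>; so \<open>z\<close> is periodic.\<close>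
    define z where "z t = 1 * w t + (- c) * r t" for t
    have w: "w \<in> W21" unfolding w_def by (rule W21_lincomb[OF u(1) p(1)])
    have w0: "solves a lam (\<lambda>_. 0) w"
      using solves_lincomb[OF u(1,2) p(1,2), of 1 "-1"] by (simp add: w_def[abs_def])
    have z: "z \<in> W21" unfolding z_def by (rule W21_lincomb[OF w r(1)])
    have z0: "solves a lam (\<lambda>_. 0) z"
      using solves_lincomb[OF w w0 r(1,2), of 1 "-c"] by (simp add: z_def[abs_def])
    have Dz: "D z x = D u x - D p x - c * D r x" if "x \<in> {0..1}" for x
      using D_lincomb[OF w r(1) that, of 1 "-c"] D_lincomb[OF u(1) p(1) that, of 1 "-1"]
      by (simp add: z_def[abs_def] w_def[abs_def])
    have "z 0 = z 1" using u p r by (simp add: z_def w_def)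
    moreover have "D z 0 = D z 1" using p r by (simp add: Dz c_def algebra_simps)
    ultimately have "z \<in> X_periodic" using z by (simp add: X_periodic_def)
    then have "z t = 0" using per z0 t by (auto simp: nonresonant_def)
    then have upr: "u t - p t = c * r t" by (simp add: z_def w_def)
    have "((\<lambda>s. v0 s * \<sigma> s) has_integral (v0 1 * D u 1 - D v0 1 * u 1) - (v0 0 * D u 0 - D v0 0 * u 0)) {0..1}"
      by (rule greens_identity[OF v0(1,2) u(1,2)]) auto
    then have I0: "((\<lambda>s. v0 s * \<sigma> s) has_integral - D u 0) {0..1}"
      using u v0 by simp
    have "((\<lambda>s. v1 s * \<sigma> s) has_integral (v1 1 * D u 1 - D v1 1 * u 1) - (v1 0 * D u 0 - D v1 0 * u 0)) {0..1}"
      by (rule greens_identity[OF v1(1,2) u(1,2)]) auto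
    then have I1: "((\<lambda>s. v1 s * \<sigma> s) has_integral D u 1) {0..1}"
      using u v1 by simp
    have "((\<lambda>s. v0 s * \<sigma> s + v1 s * \<sigma> s) has_integral - c) {0..1}"
      using has_integral_add[OF I0 I1] by (simp add: c_def)
    then have "((\<lambda>s. r t * (v0 s * \<sigma> s + v1 s * \<sigma> s)) has_integral r t * - c) {0..1}"
      by (rule has_integral_mult_right)
    from has_integral_add[OF has_integral_diff[OF greens_function_has_integral[OF GD \<sigma> t]
          greens_function_has_integral[OF GP \<sigma> t]] this]
    have "((\<lambda>s. G_D t s * \<sigma> s - G_P t s * \<sigma> s + r t * (v0 s * \<sigma> s + v1 s * \<sigma> s)) has_integral
        u t - p t + r t * - c) {0..1}"
      by (simp only: u_def p_def)
    then show "((\<lambda>s. ?k s * \<sigma> s) has_integral 0) {0..1}"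
      by (simp add: upr algebra_simps)
  qed simp
  then show ?thesis by simp
qed

theorem theorem3p10:
  fixes a :: "real \<Rightarrow> real" and lam :: real
    and G_D G_P :: "real \<Rightarrow> real \<Rightarrow> real" and r4 :: "real \<Rightarrow> real"
  assumes "a absolutely_integrable_on {0..1}"
    and "nonresonant a lam X_Dirichlet"
    and "nonresonant a lam X_periodic"
    and "is_greens_function a lam X_Dirichlet G_D"
    and "is_greens_function a lam X_periodic G_P"
    and "is_r4 a lam r4"
  shows "\<forall>t\<in>{0..1}. \<forall>s\<in>{0..1}.
     G_D t s = G_P t s + r4 t * (dt G_D 0 s - dt G_D 1 s) \<and>
     G_P t s + r4 t * (dt G_D 0 s - dt G_D 1 s)
       = G_P t s + G_P t 0 * (dt G_D 0 s - dt G_D 1 s)"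
proof (intro ballI)
  fix t s :: real assume t: "t \<in> {0..1}" and s: "s \<in> {0..1}"
  note a = assms(1) and GD = assms(4)
  obtain v0 where v0: "v0 \<in> W21" "solves a lam (\<lambda>_. 0) v0" "v0 0 = 1" "v0 1 = 0"
    by (rule homogeneous_solution_boundary_values[OF a GD])
  obtain v1 where v1: "v1 \<in> W21" "solves a lam (\<lambda>_. 0) v1" "v1 0 = 0" "v1 1 = 1"
    by (rule homogeneous_solution_boundary_values[OF a GD])
  note kernel = dirichlet_periodic_kernel[OF assms(3-6) v0 v1 t]
  have "G_D t 0 = 0"
    using dirichlet_greens_function(3)[OF a GD v0 v1 t, of 0] t v1 by simp
  then have "r4 t = G_P t 0"
    using kernel[of 0] v0 v1 by simp
  moreover have "G_D t s = G_P t s + r4 t * (dt G_D 0 s - dt G_D 1 s)"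
    using kernel[OF s] dirichlet_greens_function_dt[OF a GD v0 v1 s] by (simp add: algebra_simps)
  ultimately show "G_D t s = G_P t s + r4 t * (dt G_D 0 s - dt G_D 1 s) \<and>
     G_P t s + r4 t * (dt G_D 0 s - dt G_D 1 s) = G_P t s + G_P t 0 * (dt G_D 0 s - dt G_D 1 s)"
    by simp
qed

end
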